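(* For a positive integer $s$ let $t=s+3$, let $V=[m]$ with $m=s+3t$, and let $M\cup A\cup B\cup C$ be a partition of $V$ with $|M|=s$ and $|A|=|B|=|C|=t$. Let $\mathcal I_1=2^{V\setminus M}$, $$\mathcal I_2=\{X\subseteq V:\ |X\cap M|<0.4\,|M|\ \text{and } X\text{ meets at most two of }A,B,C\},$$ and let $\mathcal I=\mathcal I_1\cup\mathcal I_2$, a decreasing family of subsets of $V$. Let $\sigma(1),\dots,\sigma(m)$ be independent and uniformly distributed on $\{1,2,3\}$, and for $L\subseteq\{1,2,3\}$ let $\mathcal A_L$ be the event that $\sigma^{-1}(j)\in\mathcal I$ for all $j\in L$. Then for all sufficiently large $s$, $$\Pr(\mathcal A_{\{3\}})\Pr(\mathcal A_{\{1,2,3\}})>\Pr(\mathcal A_{\{1,3\}})\Pr(\mathcal A_{\{2,3\}}).$$ In particular, the following conjecture of D. Welsh is false: if $\sigma(1),\dots,\sigma(m)$ are independent with values in $[n]\cup\{\Lambda\}$ and $\Pr(\sigma(i)=j)=p$ for all $i\in[m]$, $j\in[n]$ (so $\Pr(\sigma(i)=\Lambda)=1-np$), and $\mathcal I\subseteq2^{[m]}$ is decreasing, then for all disjoint $I,J,K\subseteq[n]$ the events $\mathcal A_I$ and $\mathcal A_J$ are negatively correlated given $\mathcal A_K$, where $\mathcal A_L=\{\sigma^{-1}(j)\in\mathcal I\ \forall j\in L\}$.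
   Context: $[m]=\{1,\dots,m\}$, and $2^S$ is the set of subsets of $S$. A family $\mathcal I\subseteq2^{[m]}$ is decreasing if $Y\subseteq X\in\mathcal I$ implies $Y\in\mathcal I$. Events $\mathcal A,\mathcal B$ are negatively correlated given $\mathcal C$ (with $\Pr(\mathcal C)>0$) if $\Pr(\mathcal A\cap\mathcal B\mid\mathcal C)\le\Pr(\mathcal A\mid\mathcal C)\Pr(\mathcal B\mid\mathcal C)$. *)

theory Defs
  imports "HOL-Probability.Probability"
begin

definition decreasing_family :: "'v set \<Rightarrow> 'v set set \<Rightarrow> bool" where
  "decreasing_family V F \<longleftrightarrow> F \<subseteq> Pow V \<and> (\<forall>X\<in>F. \<forall>Y. Y \<subseteq> X \<longrightarrow> Y \<in> F)"

text \<open>The event that \<open>\<sigma>\<^sup>-\<^sup>1(j)\<close> belongs to \<open>F\<close> for all \<open>j \<in> L\<close>,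
  where the random map \<open>\<sigma>\<close> is defined on the index set \<open>V\<close>.\<close>

definition colour_event ::
  "'w measure \<Rightarrow> 'v set \<Rightarrow> ('v \<Rightarrow> 'w \<Rightarrow> 'c) \<Rightarrow> 'v set set \<Rightarrow> 'c set \<Rightarrow> 'w set" where
  "colour_event P V \<sigma> F L = {\<omega> \<in> space P. \<forall>j\<in>L. {i\<in>V. \<sigma> i \<omega> = j} \<in> F}"

text \<open>Only meaningful when \<open>C\<close> has positive probability, which every use assumes.\<close>

definition neg_correlated_given :: "'w measure \<Rightarrow> 'w set \<Rightarrow> 'w set \<Rightarrow> 'w set \<Rightarrow> bool" where
  "neg_correlated_given P A B C \<longleftrightarrow>
     \<P>(\<omega> in P. \<omega> \<in> A \<inter> B \<bar> \<omega> \<in> C)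
       \<le> \<P>(\<omega> in P. \<omega> \<in> A \<bar> \<omega> \<in> C) * \<P>(\<omega> in P. \<omega> \<in> B \<bar> \<omega> \<in> C)"

text \<open>The colour \<open>\<Lambda>\<close>, which is not in \<open>[n]\<close>, is encoded as \<open>0\<close>.
  The conditions force \<open>Pr(\<sigma>(i) = \<Lambda>) = 1 - n p\<close>.  HOL formulas cannot quantify over types,
  so the sample spaces range over a fixed type; every joint law of \<open>\<sigma>(1), \<dots>, \<sigma>(m)\<close>
  is realised on this type (by coordinate maps), and the events depend on the joint law only.\<close>

definition welsh_conjecture :: bool where
  "welsh_conjecture \<longleftrightarrow>
    (\<forall>(P :: (nat \<Rightarrow> nat) measure) (m::nat) (n::nat) (p::real)
       (\<sigma> :: nat \<Rightarrow> (nat \<Rightarrow> nat) \<Rightarrow> nat) (F :: nat set set).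
      prob_space P \<longrightarrow>
      prob_space.indep_vars P (\<lambda>_. count_space UNIV) \<sigma> {1..m} \<longrightarrow>
      (\<forall>i\<in>{1..m}. \<forall>\<omega>\<in>space P. \<sigma> i \<omega> \<in> insert 0 {1..n}) \<longrightarrow>
      (\<forall>i\<in>{1..m}. \<forall>j\<in>{1..n}. \<P>(\<omega> in P. \<sigma> i \<omega> = j) = p) \<longrightarrow>
      decreasing_family {1..m} F \<longrightarrow>
      (\<forall>I J K. I \<subseteq> {1..n} \<and> J \<subseteq> {1..n} \<and> K \<subseteq> {1..n} \<and>
         I \<inter> J = {} \<and> I \<inter> K = {} \<and> J \<inter> K = {} \<and>
         measure P (colour_event P {1..m} \<sigma> F K) > 0 \<longrightarrow>
         neg_correlated_given P (colour_event P {1..m} \<sigma> F I) (colour_event P {1..m} \<sigma> F J)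
           (colour_event P {1..m} \<sigma> F K)))"

text \<open>The parameters \<open>t\<close> and \<open>m\<close> as functions of \<open>s\<close>.\<close>

definition part_size :: "nat \<Rightarrow> nat" where
  "part_size s = s + 3"

definition ground_size :: "nat \<Rightarrow> nat" where
  "ground_size s = s + 3 * part_size s"

definition is_block_partition ::
  "nat \<Rightarrow> nat set \<Rightarrow> nat set \<Rightarrow> nat set \<Rightarrow> nat set \<Rightarrow> bool" where
  "is_block_partition s M A B C \<longleftrightarrow>
     M \<union> A \<union> B \<union> C = {1..ground_size s} \<and>
     M \<inter> A = {} \<and> M \<inter> B = {} \<and> M \<inter> C = {} \<and> A \<inter> B = {} \<and> A \<inter> C = {} \<and> B \<inter> C = {} \<and>
     card M = s \<and> card A = part_size s \<and> card B = part_size s \<and> card C = part_size s"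

definition family1 :: "'v set \<Rightarrow> 'v set \<Rightarrow> 'v set set" where
  "family1 V M = Pow (V - M)"

text \<open>Counting the blocks met by \<open>X\<close> as members of \<open>{A, B, C}\<close> is correct because the
  blocks of a partition into nonempty parts are distinct.\<close>

definition family2 :: "'v set \<Rightarrow> 'v set \<Rightarrow> 'v set \<Rightarrow> 'v set \<Rightarrow> 'v set \<Rightarrow> 'v set set" where
  "family2 V M A B C =
     {X. X \<subseteq> V \<and> real (card (X \<inter> M)) < 0.4 * real (card M) \<and>
         card {Z \<in> {A, B, C}. X \<inter> Z \<noteq> {}} \<le> 2}"

definition block_family :: "'v set \<Rightarrow> 'v set \<Rightarrow> 'v set \<Rightarrow> 'v set \<Rightarrow> 'v set \<Rightarrow> 'v set set" where
  "block_family V M A B C = family1 V M \<union> family2 V M A B C"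

definition iid_uniform_colouring :: "'w measure \<Rightarrow> 'v set \<Rightarrow> ('v \<Rightarrow> 'w \<Rightarrow> nat) \<Rightarrow> bool" where
  "iid_uniform_colouring P V \<sigma> \<longleftrightarrow>
     prob_space P \<and>
     prob_space.indep_vars P (\<lambda>_. count_space UNIV) \<sigma> V \<and>
     (\<forall>i\<in>V. distr P (count_space UNIV) (\<sigma> i) = measure_pmf (pmf_of_set {1, 2, 3}))"

end

theory Submission
  imports Defs "HOL-Combinatorics.Permutations"
begin

text \<open>Up to exponentially rare events every colour has fewer than \<open>2 s / 5\<close> elements of \<open>M\<close>, and
  then a colour class belongs to the family iff it misses a block.  With \<open>q = (2/3)\<^sup>t\<close>, which is
  \<open>8/27\<close> times \<open>(2/3)\<^sup>s\<close>, a single colour is good either by missing \<open>M\<close> (probability \<open>(2/3)\<^sup>s\<close>)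
  or by missing a block (about \<open>3 q\<close>), so \<open>Pr {3}\<close> is about \<open>17/9 (2/3)\<^sup>s\<close>.  If two colours must be
  good, then missing \<open>M\<close> no longer helps: the other colour then takes about half of \<open>M\<close>.  The main
  contribution is that the colours miss different blocks, so \<open>Pr {1, 3}\<close> and \<open>Pr {2, 3}\<close> are about
  \<open>6 q\<^sup>2\<close> and \<open>Pr {1, 2, 3}\<close> is about \<open>6 q\<^sup>3\<close>.  The claim reduces to \<open>17/9 \<cdot> 6 \<cdot> 27/8 > 36\<close>.\<close>

section \<open>Bonferroni's lower bound and exponential tail bounds for counting colourings\<close>

text \<open>The double sum runs over ordered pairs, so every intersection is subtracted twice. This
  crude form suffices because the intersections are of lower order in both applications. In the
  induction the overlap of the new set \<open>E k\<close> with the old union is paid for by the new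
  row \<open>i = k\<close>.\<close>

lemma (in finite_measure) measure_UN_ge_Bonferroni:
  assumes "finite I" "\<And>i. i \<in> I \<Longrightarrow> E i \<in> sets M"
  shows "measure M (\<Union>i\<in>I. E i) \<ge>
    (\<Sum>i\<in>I. measure M (E i)) - (\<Sum>i\<in>I. \<Sum>j\<in>I - {i}. measure M (E i \<inter> E j))"
  using assms
proof (induction I rule: finite_induct)
  case empty
  then show ?case by simp
next
  case (insert k I)
  let ?U = "\<Union>i\<in>I. E i"
  have sets: "E k \<in> sets M" "?U \<in> sets M"
    using insert by auto
  have "measure M (E k \<inter> ?U) = measure M (\<Union>i\<in>I. E k \<inter> E i)"
    by simp
  also have "\<dots> \<le> (\<Sum>i\<in>I. measure M (E k \<inter> E i))"
    using insert by (intro finite_measure_subadditive_finite) auto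
  finally have cross: "measure M (E k \<inter> ?U) \<le> (\<Sum>i\<in>I. measure M (E k \<inter> E i))" .
  have "measure M (E k \<union> ?U) = measure M (E k) + measure M ?U - measure M (E k \<inter> ?U)"
    using measure_Un3[of "E k" M ?U] sets by (simp add: fmeasurable_eq_sets)
  \<comment> \<open>The new column \<open>j = k\<close> of the double sum only lowers the
    bound.\<close>
  moreover have "(\<Sum>i\<in>I. \<Sum>j\<in>insert k I - {i}. measure M (E i \<inter> E j))
      \<ge> (\<Sum>i\<in>I. \<Sum>j\<in>I - {i}. measure M (E i \<inter> E j))"
    using insert by (intro sum_mono sum_mono2) auto
  ultimately show ?case
    using insert cross by (simp add: Diff_insert_absorb)
qed

lemma sum_PiE_prod_const:
  fixes w :: "'c \<Rightarrow> 'a::comm_semiring_1"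
  assumes "finite M" "finite K"
  shows "(\<Sum>f\<in>M \<rightarrow>\<^sub>E K. \<Prod>i\<in>M. w (f i)) = (\<Sum>c\<in>K. w c) ^ card M"
  using prod_sum_PiE[of M "\<lambda>_. K" "\<lambda>_. w"] assms by simp

text \<open>An exponential Markov bound: a colouring weighs \<open>h\<^sup>3\<close> per point of colour \<open>b\<close> and
  \<open>h\<^sup>-\<^sup>2\<close> per other point, so its weight compares with \<open>1\<close> as the fraction of colour \<open>b\<close>
  compares with \<open>2/5\<close>.\<close>

lemma card_colourings_tail_le:
  fixes h :: real
  assumes "finite M" "finite K" "b \<in> K" "h > 0"
  shows "real (card {f \<in> M \<rightarrow>\<^sub>E K. h ^ (2 * (card M - card {i\<in>M. f i = b})) \<le> h ^ (3 * card {i\<in>M. f i = b})})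
    \<le> (h ^ 3 + (card K - 1) / h ^ 2) ^ card M"
    (is "real (card ?S) \<le> _")
proof -
  define w where "w c = (if c = b then h ^ 3 else 1 / h ^ 2)" for c
  have fin: "finite (M \<rightarrow>\<^sub>E K)"
    using assms by (simp add: finite_PiE)
  have w0: "w c \<ge> 0" for c
    using assms by (simp add: w_def)
  have weight: "(\<Prod>i\<in>M. w (f i)) \<ge> 1" if "f \<in> ?S" for f
  proof -
    let ?x = "card {i\<in>M. f i = b}"
    have "card {i\<in>M. f i \<noteq> b} = card (M - {i\<in>M. f i = b})"
      by (rule arg_cong[where f = card]) auto
    then have "card {i\<in>M. f i \<noteq> b} = card M - ?x"
      using assms by (simp add: card_Diff_subset)
    moreover have "M \<inter> {i. f i = b} = {i\<in>M. f i = b}" "M \<inter> - {i. f i = b} = {i\<in>M. f i \<noteq> b}"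
      by auto
    ultimately have "(\<Prod>i\<in>M. w (f i)) = (h ^ 3) ^ ?x * (1 / h ^ 2) ^ (card M - ?x)"
      using assms by (simp add: w_def prod.If_cases)
    also have "\<dots> = h ^ (3 * ?x) / h ^ (2 * (card M - ?x))"
      by (simp add: power_mult power_one_over divide_inverse power_inverse)
    finally show ?thesis
      using that assms by simp
  qed
  have "real (card ?S) = (\<Sum>f\<in>?S. 1)"
    by simp
  also have "\<dots> \<le> (\<Sum>f\<in>?S. \<Prod>i\<in>M. w (f i))"
    using weight by (intro sum_mono) auto
  also have "\<dots> \<le> (\<Sum>f\<in>M \<rightarrow>\<^sub>E K. \<Prod>i\<in>M. w (f i))"
    using fin w0 by (intro sum_mono2 prod_nonneg) auto
  also have "\<dots> = (\<Sum>c\<in>K. w c) ^ card M"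
    using assms by (simp add: sum_PiE_prod_const)
  also have "(\<Sum>c\<in>K. w c) = h ^ 3 + (card K - 1) / h ^ 2"
  proof -
    have "(\<Sum>c\<in>K. w c) = w b + (\<Sum>c\<in>K - {b}. w c)"
      using assms by (simp add: sum.remove)
    also have "(\<Sum>c\<in>K - {b}. w c) = (\<Sum>c\<in>K - {b}. 1 / h ^ 2)"
      by (intro sum.cong) (auto simp: w_def)
    moreover have "card K \<ge> 1"
      using assms by (metis One_nat_def Suc_leI card_gt_0_iff empty_iff)
    ultimately show ?thesis
      using assms by (simp add: w_def of_nat_diff)
  qed
  finally show ?thesis .
qed

text \<open>The choice \<open>h = 11/10 > 1\<close> works since a share of at least 2/5 means that
  three times the class of \<open>b\<close> is at least twice the rest. The base is about 2.984,
  below the 3 for all colourings, so the proportion decays exponentially. This reflects 2/5 >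
  1/3.\<close>

lemma card_colourings_upper_tail:
  assumes "finite M" "b \<in> {1,2,3}"
  shows "real (card {f \<in> M \<rightarrow>\<^sub>E {1,2,3::nat}. 2 * card M \<le> 5 * card {i\<in>M. f i = b}})
    \<le> (1331/1000 + 200/121) ^ card M"
proof -
  let ?x = "\<lambda>f. card {i\<in>M. f i = b}"
  have "card {f \<in> M \<rightarrow>\<^sub>E {1,2,3::nat}. 2 * card M \<le> 5 * ?x f} \<le>
      card {f \<in> M \<rightarrow>\<^sub>E {1,2,3::nat}. (11/10::real) ^ (2 * (card M - ?x f)) \<le> (11/10) ^ (3 * ?x f)}"
    using assms by (intro card_mono) (auto simp: finite_PiE intro!: power_increasing)
  also have "real \<dots> \<le> ((11/10) ^ 3 + (card {1,2,3::nat} - 1) / (11/10) ^ 2) ^ card M"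
    using assms by (intro card_colourings_tail_le) auto
  finally show ?thesis
    by (simp add: power3_eq_cube power2_eq_square)
qed

text \<open>Now \<open>h = 9/10 < 1\<close> rewards a shortage of colour \<open>b\<close>. The base
  is about 1.964, below the 2 for all colourings with two colours. This reflects 2/5 < 1/2.\<close>

lemma card_colourings_lower_tail:
  assumes "finite M" "finite K" "card K = 2" "b \<in> K"
  shows "real (card {f \<in> M \<rightarrow>\<^sub>E K. 5 * card {i\<in>M. f i = b} < 2 * card M})
    \<le> (729/1000 + 100/81) ^ card M"
proof -
  let ?x = "\<lambda>f. card {i\<in>M. f i = b}"
  have "card {f \<in> M \<rightarrow>\<^sub>E K. 5 * ?x f < 2 * card M} \<le>
      card {f \<in> M \<rightarrow>\<^sub>E K. (9/10::real) ^ (2 * (card M - ?x f)) \<le> (9/10) ^ (3 * ?x f)}"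
    using assms by (intro card_mono) (auto simp: finite_PiE intro!: power_decreasing)
  also have "real \<dots> \<le> ((9/10) ^ 3 + (card K - 1) / (9/10) ^ 2) ^ card M"
    using assms by (intro card_colourings_tail_le) auto
  finally show ?thesis
    using assms by (simp add: power3_eq_cube power2_eq_square)
qed

section \<open>Properties that depend only on part of a colouring\<close>

text \<open>Such a predicate takes the same value on the random colouring, a total function, and on
  its restriction in \<open>M \<rightarrow>\<^sub>E K\<close>, so that its probability can be found
  by counting restrictions.\<close>

definition determined_on :: "'v set \<Rightarrow> (('v \<Rightarrow> 'c) \<Rightarrow> bool) \<Rightarrow> bool" where
  "determined_on J Q \<longleftrightarrow> (\<forall>f g. (\<forall>i\<in>J. f i = g i) \<longrightarrow> Q f = Q g)"

lemma determined_onD: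
  "determined_on J Q \<Longrightarrow> (\<And>i. i \<in> J \<Longrightarrow> f i = g i) \<Longrightarrow> Q f = Q g"
  unfolding determined_on_def by blast

lemma determined_onI:
  "(\<And>f g. (\<And>i. i \<in> J \<Longrightarrow> f i = g i) \<Longrightarrow> Q f = Q g) \<Longrightarrow> determined_on J Q"
  unfolding determined_on_def by blast

lemma determined_on_not:
  assumes "determined_on J Q"
  shows "determined_on J (\<lambda>f. \<not> Q f)"
proof (rule determined_onI)
  fix f g :: "'a \<Rightarrow> 'b"
  assume "\<And>i. i \<in> J \<Longrightarrow> f i = g i"
  then have "Q f = Q g" by (rule determined_onD[OF assms])
  then show "(\<not> Q f) = (\<not> Q g)" by simp
qed

lemma determined_on_conj:
  assumes "determined_on J Q" "determined_on K R" "J \<subseteq> L" "K \<subseteq> L"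
  shows "determined_on L (\<lambda>f. Q f \<and> R f)"
proof (rule determined_onI)
  fix f g :: "'a \<Rightarrow> 'b"
  assume eq: "\<And>i. i \<in> L \<Longrightarrow> f i = g i"
  have "Q f = Q g"
    by (rule determined_onD[OF assms(1)]) (use eq assms(3) in auto)
  moreover have "R f = R g"
    by (rule determined_onD[OF assms(2)]) (use eq assms(4) in auto)
  ultimately show "(Q f \<and> R f) = (Q g \<and> R g)" by simp
qed

section \<open>Uniform random colourings: measurability and product formulas\<close>

locale uniform_colouring = prob_space P for P :: "'w measure" +
  fixes V :: "'v set" and \<sigma> :: "'v \<Rightarrow> 'w \<Rightarrow> nat"
  assumes finite_V: "finite V"
    and indep: "indep_vars (\<lambda>_. count_space UNIV) \<sigma> V"
    and unif: "i \<in> V \<Longrightarrow> distr P (count_space UNIV) (\<sigma> i) = measure_pmf (pmf_of_set {1, 2, 3})"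
begin

definition ev :: "(('v \<Rightarrow> nat) \<Rightarrow> bool) \<Rightarrow> 'w set" where
  "ev Q = {\<omega> \<in> space P. Q (\<lambda>i. \<sigma> i \<omega>)}"

lemma random_variable_colour [measurable]:
  "i \<in> V \<Longrightarrow> \<sigma> i \<in> measurable P (count_space UNIV)"
  using indep by (auto simp: indep_vars_def)

lemma prob_colour_in:
  assumes "i \<in> V"
  shows "prob (\<sigma> i -` D \<inter> space P) = card (D \<inter> {1,2,3}) / 3"
proof -
  have "prob (\<sigma> i -` D \<inter> space P) = measure (distr P (count_space UNIV) (\<sigma> i)) D"
    using assms by (simp add: measure_distr)
  also have "\<dots> = card ({1,2,3} \<inter> D) / 3"
    using assms by (simp add: unif measure_pmf_of_set)
  finally show ?thesis by (simp add: Int_commute)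
qed

lemma prob_rectangle:
  assumes "J \<subseteq> V"
  shows "prob (ev (\<lambda>f. \<forall>i\<in>J. f i \<in> D i)) = (\<Prod>i\<in>J. card (D i \<inter> {1,2,3}) / 3)"
\<comment> \<open>The product rule for independent variables concerns nonempty index sets, so the
  empty product is treated apart.\<close>
proof (cases "J = {}")
  case True
  then show ?thesis by (simp add: ev_def prob_space)
next
  case False
  have "ev (\<lambda>f. \<forall>i\<in>J. f i \<in> D i) = (\<Inter>i\<in>J. \<sigma> i -` D i \<inter> space P)"
    using False by (auto simp: ev_def)
  also have "prob \<dots> = (\<Prod>i\<in>J. prob (\<sigma> i -` D i \<inter> space P))"
    using False assms finite_V
    by (intro indep_varsD[OF indep]) (auto intro: finite_subset)
  finally show ?thesis
    using assms by (simp add: prob_colour_in subset_iff)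
qed

lemma events_rectangle:
  assumes "J \<subseteq> V"
  shows "ev (\<lambda>f. \<forall>i\<in>J. f i \<in> D i) \<in> events"
proof -
  have "finite J" using assms finite_V by (rule finite_subset)
  moreover have "{\<omega> \<in> space P. \<sigma> i \<omega> \<in> D i} \<in> events" if "i \<in> J" for i
  proof -
    have "i \<in> V" using that assms by auto
    from measurable_sets[OF random_variable_colour[OF this], of "D i"]
    have "\<sigma> i -` D i \<inter> space P \<in> events" by simp
    also have "\<sigma> i -` D i \<inter> space P = {\<omega> \<in> space P. \<sigma> i \<omega> \<in> D i}" by auto
    finally show ?thesis .
  qed
  ultimately show ?thesis
    unfolding ev_def by (intro sets.sets_Collect_finite_All) auto
qed

text \<open>The event is split by the restriction of the colouring to the finite set
  \<open>J\<close>, each restriction giving a rectangle. Values outside \<open>{1,2,3}\<close> are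
  excluded only almost surely, so the union need not be finite, but it is countable because colours
  are natural numbers.\<close>

lemma events_determined_on:
  assumes "J \<subseteq> V" "determined_on J Q"
  shows "ev Q \<in> events"
proof -
  have finJ: "finite J" using assms(1) finite_V by (rule finite_subset)
  have "ev Q = (\<Union>g\<in>{g \<in> J \<rightarrow>\<^sub>E UNIV. Q g}. ev (\<lambda>f. \<forall>i\<in>J. f i \<in> {g i}))"
  proof (intro equalityI subsetI)
    fix \<omega> assume \<omega>: "\<omega> \<in> ev Q"
    let ?g = "restrict (\<lambda>i. \<sigma> i \<omega>) J"
    have "Q ?g = Q (\<lambda>i. \<sigma> i \<omega>)"
      by (intro determined_onD[OF assms(2)]) simp
    then show "\<omega> \<in> (\<Union>g\<in>{g \<in> J \<rightarrow>\<^sub>E UNIV. Q g}. ev (\<lambda>f. \<forall>i\<in>J. f i \<in> {g i}))"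
      using \<omega> by (intro UN_I[of ?g]) (auto simp: ev_def)
  next
    fix \<omega> assume "\<omega> \<in> (\<Union>g\<in>{g \<in> J \<rightarrow>\<^sub>E UNIV. Q g}. ev (\<lambda>f. \<forall>i\<in>J. f i \<in> {g i}))"
    then obtain g where "Q g" "\<omega> \<in> space P" "\<forall>i\<in>J. \<sigma> i \<omega> = g i"
      by (auto simp: ev_def)
    moreover from this have "Q (\<lambda>i. \<sigma> i \<omega>) = Q g"
      by (intro determined_onD[OF assms(2)]) simp
    ultimately show "\<omega> \<in> ev Q"
      by (simp add: ev_def)
  qed
  moreover have "(\<Union>g\<in>{g \<in> J \<rightarrow>\<^sub>E UNIV. Q g}. ev (\<lambda>f. \<forall>i\<in>J. f i \<in> {g i})) \<in> events"
  proof (rule sets.countable_UN'')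
    show "countable {g \<in> J \<rightarrow>\<^sub>E (UNIV::nat set). Q g}"
      by (rule countable_subset[OF _ countable_PiE[OF finJ]]) auto
  qed (rule events_rectangle[OF assms(1)])
  ultimately show ?thesis
    by simp
qed

lemma AE_colours: "AE \<omega> in P. \<forall>i\<in>V. \<sigma> i \<omega> \<in> {1,2,3}"
proof -
  have "prob (ev (\<lambda>f. \<forall>i\<in>V. f i \<in> {1,2,3})) = 1"
    using prob_rectangle[of V "\<lambda>_. {1,2,3}"] by simp
  then have "AE \<omega> in P. \<omega> \<in> ev (\<lambda>f. \<forall>i\<in>V. f i \<in> {1,2,3})"
    by (rule AE_prob_1)
  then show ?thesis
    by (rule eventually_mono) (simp add: ev_def)
qed

text \<open>An arbitrary condition on \<open>M\<close> contributes a count, and pointwise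
  constraints elsewhere contribute a product. The event is cut into disjoint rectangles, one for
  each admissible restriction to \<open>M\<close>.\<close>

lemma prob_cylinder:
  assumes "M \<subseteq> V" "J \<subseteq> V" "M \<inter> J = {}" "determined_on M Q"
  shows "prob (ev (\<lambda>f. Q f \<and> (\<forall>i\<in>J. f i \<in> D i))) =
    card {f \<in> M \<rightarrow>\<^sub>E {1,2,3}. Q f} / 3 ^ card M * (\<Prod>i\<in>J. card (D i \<inter> {1,2,3}) / 3)"
proof -
  have fin: "finite M" "finite J" using assms(1,2) finite_V by (auto intro: finite_subset)
  define G where "G = {f \<in> M \<rightarrow>\<^sub>E {1,2,3::nat}. Q f}"
  have finG: "finite G"
    using fin by (simp add: G_def finite_PiE)
  \<comment> \<open>Fixing the values on \<open>M\<close> and constraining those on \<open>J\<close>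
    is one rectangle over \<open>M \<union> J\<close>.\<close>
  define D' where "D' g i = (if i \<in> M then {g i} else D i)" for g i
  define R where "R g = ev (\<lambda>f. \<forall>i\<in>M \<union> J. f i \<in> D' g i)" for g
  have R: "\<omega> \<in> R g \<longleftrightarrow> \<omega> \<in> space P \<and> (\<forall>i\<in>M. \<sigma> i \<omega> = g i) \<and> (\<forall>i\<in>J. \<sigma> i \<omega> \<in> D i)" for \<omega> g
  proof -
    have "i \<notin> M" if "i \<in> J" for i
      using that assms(3) by blast
    then show ?thesis
      by (simp add: R_def D'_def ev_def ball_Un)
  qed
  have R_events: "R g \<in> events" for g
    using assms unfolding R_def by (intro events_rectangle) auto
  have Q_events: "ev (\<lambda>f. Q f \<and> (\<forall>i\<in>J. f i \<in> D i)) \<in> events"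
    using assms
    by (intro events_determined_on[of "M \<union> J"] determined_on_conj[of M _ J])
      (auto simp: determined_on_def)
  have "prob (ev (\<lambda>f. Q f \<and> (\<forall>i\<in>J. f i \<in> D i))) = prob (\<Union>g\<in>G. R g)"
  proof (rule finite_measure_eq_AE)
    \<comment> \<open>Equality can fail on a null set: a colouring with a stray value on
      \<open>M\<close> lies in no \<open>R g\<close>.\<close>
    show "AE \<omega> in P. \<omega> \<in> ev (\<lambda>f. Q f \<and> (\<forall>i\<in>J. f i \<in> D i)) \<longleftrightarrow> \<omega> \<in> (\<Union>g\<in>G. R g)"
    proof (rule eventually_mono[OF AE_colours], rule iffI)
      fix \<omega> assume col: "\<forall>i\<in>V. \<sigma> i \<omega> \<in> {1,2,3}"
        and \<omega>: "\<omega> \<in> ev (\<lambda>f. Q f \<and> (\<forall>i\<in>J. f i \<in> D i))"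
      let ?g = "restrict (\<lambda>i. \<sigma> i \<omega>) M"
      have "Q ?g = Q (\<lambda>i. \<sigma> i \<omega>)"
        by (intro determined_onD[OF assms(4)]) simp
      then have "?g \<in> G"
        using \<omega> col assms(1) by (auto simp: G_def ev_def PiE_iff)
      moreover have "\<omega> \<in> R ?g"
        using \<omega> by (auto simp: R ev_def)
      ultimately show "\<omega> \<in> (\<Union>g\<in>G. R g)" by blast
    next
      fix \<omega> assume "\<omega> \<in> (\<Union>g\<in>G. R g)"
      then obtain g where g: "Q g" "\<omega> \<in> R g" by (auto simp: G_def)
      then have "Q (\<lambda>i. \<sigma> i \<omega>) = Q g"
        by (intro determined_onD[OF assms(4)]) (simp add: R)
      then show "\<omega> \<in> ev (\<lambda>f. Q f \<and> (\<forall>i\<in>J. f i \<in> D i))"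
        using g by (auto simp: R ev_def)
    qed
    show "(\<Union>g\<in>G. R g) \<in> events"
      using finG R_events by auto
  qed (use Q_events in auto)
  also have "\<dots> = (\<Sum>g\<in>G. prob (R g))"
  proof (rule finite_measure_finite_Union)
    show "disjoint_family_on R G"
    proof (unfold disjoint_family_on_def, intro ballI impI)
      fix g h assume "g \<in> G" "h \<in> G" "g \<noteq> h"
      then obtain i where "i \<in> M" "g i \<noteq> h i"
        unfolding G_def by (metis (no_types, lifting) PiE_ext mem_Collect_eq)
      then show "R g \<inter> R h = {}"
        by (auto simp: R)
    qed
  qed (use finG R_events in auto)
  also have "(\<Sum>g\<in>G. prob (R g)) = (\<Sum>g\<in>G. 1 / 3 ^ card M * (\<Prod>i\<in>J. card (D i \<inter> {1,2,3}) / 3))"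
  proof (rule sum.cong)
    fix g assume g: "g \<in> G"
    have "prob (R g) = (\<Prod>i\<in>M \<union> J. card (D' g i \<inter> {1,2,3}) / 3)"
      unfolding R_def using assms by (intro prob_rectangle) auto
    also have "\<dots> = (\<Prod>i\<in>M. card (D' g i \<inter> {1,2,3}) / 3) * (\<Prod>i\<in>J. card (D' g i \<inter> {1,2,3}) / 3)"
      using fin assms by (intro prod.union_disjoint) auto
    also have "(\<Prod>i\<in>M. card (D' g i \<inter> {1,2,3}) / 3) = (\<Prod>i\<in>M. 1 / 3 :: real)"
    proof (rule prod.cong)
      fix i assume "i \<in> M"
      then have "D' g i \<inter> {1,2,3} = {g i}"
        using g by (auto simp: D'_def G_def PiE_iff)
      then show "card (D' g i \<inter> {1,2,3}) / 3 = (1 / 3 :: real)" by simp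
    qed simp
    also have "(\<Prod>i\<in>J. card (D' g i \<inter> {1,2,3}) / 3) = (\<Prod>i\<in>J. card (D i \<inter> {1,2,3}) / 3 :: real)"
      using assms by (intro prod.cong) (auto simp: D'_def)
    finally show "prob (R g) = 1 / 3 ^ card M * (\<Prod>i\<in>J. card (D i \<inter> {1,2,3}) / 3)"
      by (simp add: power_one_over)
  qed simp
  finally show ?thesis by (simp add: G_def)
qed

lemma prob_determined_on:
  assumes "M \<subseteq> V" "determined_on M Q"
  shows "prob (ev Q) = card {f \<in> M \<rightarrow>\<^sub>E {1,2,3}. Q f} / 3 ^ card M"
  using prob_cylinder[of M "{}" Q] assms by simp

end

section \<open>Blocks, and the events that decide whether a colour class is in the family\<close>

text \<open>The blocks form an unordered set, so sums and products over blocks replace case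
  distinctions on their names.\<close>

locale block_colouring = uniform_colouring P V \<sigma>
  for P :: "'w measure" and V :: "'v set" and \<sigma> :: "'v \<Rightarrow> 'w \<Rightarrow> nat" +
  fixes M :: "'v set" and Bs :: "'v set set" and t :: nat
  assumes V_eq: "V = M \<union> \<Union>Bs"
    and M_disj: "Z \<in> Bs \<Longrightarrow> M \<inter> Z = {}"
    and Bs_disj: "disjoint Bs"
    and card_Bs: "card Bs = 3"
    and card_block: "Z \<in> Bs \<Longrightarrow> card Z = t"
begin

definition none :: "nat \<Rightarrow> ('v \<Rightarrow> nat) \<Rightarrow> bool" where
  "none j f \<longleftrightarrow> (\<forall>i\<in>M. f i \<noteq> j)"

text \<open>This is the condition \<open>card (X \<inter> M) < 0.4 * card M\<close> in integers, for
  \<open>X\<close> the class of colour \<open>j\<close>.\<close>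

definition few :: "nat \<Rightarrow> ('v \<Rightarrow> nat) \<Rightarrow> bool" where
  "few j f \<longleftrightarrow> 5 * card {i\<in>M. f i = j} < 2 * card M"

definition misses :: "'v set \<Rightarrow> nat \<Rightarrow> ('v \<Rightarrow> nat) \<Rightarrow> bool" where
  "misses Z j f \<longleftrightarrow> (\<forall>i\<in>Z. f i \<noteq> j)"

text \<open>This is membership of the class of \<open>j\<close> in the block family, by
  \<open>colour_class_in_block_family_iff\<close>.\<close>

definition good :: "nat \<Rightarrow> ('v \<Rightarrow> nat) \<Rightarrow> bool" where
  "good j f \<longleftrightarrow> none j f \<or> few j f \<and> (\<exists>Z\<in>Bs. misses Z j f)"

text \<open>\<open>X Z\<close> is the set of colours forbidden on the block \<open>Z\<close>. For
  fixed \<open>Q\<close> these events are closed under intersection, by taking unions of the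
  forbidden sets, which suits the Bonferroni bound.\<close>

definition avoiding :: "(('v \<Rightarrow> nat) \<Rightarrow> bool) \<Rightarrow> ('v set \<Rightarrow> nat set) \<Rightarrow> 'w set" where
  "avoiding Q X = ev (\<lambda>f. Q f \<and> (\<forall>Z\<in>Bs. \<forall>i\<in>Z. f i \<notin> X Z))"

lemma M_subset: "M \<subseteq> V"
  using V_eq by auto

lemma finite_M: "finite M"
  using M_subset finite_V by (rule finite_subset)

lemma determined_on_none [simp]: "determined_on M (none j)"
  by (auto simp: determined_on_def none_def)

lemma determined_on_few [simp]: "determined_on M (few j)"
  unfolding determined_on_def
proof (intro allI impI)
  fix f g :: "'v \<Rightarrow> nat"
  assume "\<forall>i\<in>M. f i = g i"
  then have "{i\<in>M. f i = j} = {i\<in>M. g i = j}" by auto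
  then show "few j f = few j g" by (simp add: few_def)
qed

lemma determined_on_misses: "Z \<in> Bs \<Longrightarrow> determined_on V (misses Z j)"
proof (rule determined_onI)
  fix f g :: "'v \<Rightarrow> nat"
  assume "Z \<in> Bs" and "\<And>i. i \<in> V \<Longrightarrow> f i = g i"
  then have "f i = g i" if "i \<in> Z" for i
    using that V_eq by blast
  then show "misses Z j f = misses Z j g"
    by (simp add: misses_def)
qed

lemma determined_on_good: "determined_on V (good j)"
proof (rule determined_onI)
  fix f g :: "'v \<Rightarrow> nat"
  assume eq: "\<And>i. i \<in> V \<Longrightarrow> f i = g i"
  have "none j f = none j g"
    by (rule determined_onD[OF determined_on_none]) (use eq M_subset in auto)
  moreover have "few j f = few j g"
    by (rule determined_onD[OF determined_on_few]) (use eq M_subset in auto)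
  moreover have "misses Z j f = misses Z j g" if "Z \<in> Bs" for Z
    by (rule determined_onD[OF determined_on_misses[OF that]]) (rule eq)
  ultimately show "good j f = good j g"
    by (simp add: good_def)
qed

lemma events_good [simp]: "ev (\<lambda>f. \<forall>j\<in>L. good j f) \<in> events"
proof (rule events_determined_on[OF subset_refl], rule determined_onI, rule ball_cong[OF refl])
  fix f g :: "'v \<Rightarrow> nat" and j
  assume "\<And>i. i \<in> V \<Longrightarrow> f i = g i"
  then show "good j f = good j g"
    by (rule determined_onD[OF determined_on_good])
qed

lemma blocks_obtain:
  obtains A B C where "Bs = {A, B, C}" "A \<noteq> B" "A \<noteq> C" "B \<noteq> C"
  using card_Bs by (auto simp: card_3_iff)

lemma finite_Bs [simp]: "finite Bs"
  using card_Bs by (metis card.infinite zero_neq_numeral)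

lemma events_avoiding [simp]:
  assumes "determined_on M Q"
  shows "avoiding Q X \<in> events"
proof -
  have "determined_on V (\<lambda>f. \<forall>Z\<in>Bs. \<forall>i\<in>Z. f i \<notin> X Z)"
  proof (rule determined_onI)
    fix f g :: "'v \<Rightarrow> nat"
    assume "\<And>i. i \<in> V \<Longrightarrow> f i = g i"
    then have "f i = g i" if "Z \<in> Bs" "i \<in> Z" for Z i
      using that V_eq by blast
    then show "(\<forall>Z\<in>Bs. \<forall>i\<in>Z. f i \<notin> X Z) = (\<forall>Z\<in>Bs. \<forall>i\<in>Z. g i \<notin> X Z)"
      by simp
  qed
  then show ?thesis
    unfolding avoiding_def
    by (intro events_determined_on[OF subset_refl] determined_on_conj[OF assms _ M_subset subset_refl])
qed

text \<open>The set \<open>M\<close> and the blocks are coloured independently, and each of the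
  \<open>t\<close> points of \<open>Z\<close> has \<open>3 - card (X Z)\<close> allowed
  colours.\<close>

lemma prob_avoiding:
  assumes Q: "determined_on M Q" and X: "\<And>Z. Z \<in> Bs \<Longrightarrow> X Z \<subseteq> {1,2,3}"
  shows "prob (avoiding Q X) = prob (ev Q) * (\<Prod>Z\<in>Bs. (real (3 - card (X Z)) / 3) ^ t)"
proof -
  \<comment> \<open>The block of a point is unique by disjointness. It turns constraints indexed by
    blocks into constraints indexed by points, as \<open>prob_cylinder\<close> expects.\<close>
  define blk where "blk i = (THE Z. Z \<in> Bs \<and> i \<in> Z)" for i
  have blk: "blk i = Z" if "Z \<in> Bs" "i \<in> Z" for i Z
    unfolding blk_def
  proof (rule the_equality)
    fix Y assume "Y \<in> Bs \<and> i \<in> Y"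
    then show "Y = Z" using that Bs_disj by (meson disjointD disjoint_iff)
  qed (use that in auto)
  have "avoiding Q X = ev (\<lambda>f. Q f \<and> (\<forall>i\<in>\<Union>Bs. f i \<in> - X (blk i)))"
    by (auto simp: avoiding_def ev_def blk)
  also have "prob \<dots> = card {f \<in> M \<rightarrow>\<^sub>E {1,2,3}. Q f} / 3 ^ card M *
      (\<Prod>i\<in>\<Union>Bs. card (- X (blk i) \<inter> {1,2,3}) / 3)"
    using Q M_disj by (intro prob_cylinder) (auto simp: V_eq)
  also have "card {f \<in> M \<rightarrow>\<^sub>E {1,2,3}. Q f} / 3 ^ card M = prob (ev Q)"
    using prob_determined_on[OF M_subset Q] by simp
  also have "(\<Prod>i\<in>\<Union>Bs. card (- X (blk i) \<inter> {1,2,3}) / 3 :: real) =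
      (\<Prod>Z\<in>Bs. \<Prod>i\<in>Z. card (- X (blk i) \<inter> {1,2,3}) / 3)"
  proof -
    have "\<forall>Z\<in>Bs. finite Z"
      using finite_V by (auto simp: V_eq intro: finite_subset)
    moreover have "\<forall>A\<in>Bs. \<forall>B\<in>Bs. A \<noteq> B \<longrightarrow> A \<inter> B = {}"
      using Bs_disj by (simp add: disjointD)
    ultimately show ?thesis
      by (subst prod.Union_disjoint) (simp_all add: comp_def)
  qed
  also have "\<dots> = (\<Prod>Z\<in>Bs. (real (3 - card (X Z)) / 3) ^ t)"
  proof (rule prod.cong)
    fix Z assume Z: "Z \<in> Bs"
    have "- X Z \<inter> {1,2,3} = {1,2,3} - X Z" by auto
    then have "card (- X Z \<inter> {1,2,3}) = 3 - card (X Z)"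
      using X[OF Z] by (simp add: card_Diff_subset finite_subset)
    then have "(\<Prod>i\<in>Z. card (- X (blk i) \<inter> {1,2,3}) / 3 :: real) = (\<Prod>i\<in>Z. real (3 - card (X Z)) / 3)"
      using Z by (intro prod.cong) (simp_all add: blk)
    then show "(\<Prod>i\<in>Z. card (- X (blk i) \<inter> {1,2,3}) / 3 :: real) = (real (3 - card (X Z)) / 3) ^ t"
      using Z by (simp add: card_block)
  qed simp
  finally show ?thesis .
qed

lemma prob_none:
  assumes "j \<in> {1,2,3}"
  shows "prob (ev (none j)) = (2/3) ^ card M"
proof -
  have "- {j} \<inter> {1,2,3} = {1,2,3} - {j}" by auto
  then have "card (- {j} \<inter> {1,2,3::nat}) = 2"
    using assms by (simp add: card_Diff_subset)
  then show ?thesis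
    using prob_rectangle[OF M_subset, of "\<lambda>_. - {j}"] by (simp add: none_def[abs_def])
qed

lemma prob_none_none:
  assumes "a \<in> {1,2,3}" "b \<in> {1,2,3}" "a \<noteq> b"
  shows "prob (ev (\<lambda>f. none a f \<and> none b f)) = (1/3) ^ card M"
proof -
  have "- {a,b} \<inter> {1,2,3} = {1,2,3} - {a,b}" by auto
  then have c: "card (- {a,b} \<inter> {1,2,3::nat}) = 1"
    using assms by (simp add: card_Diff_subset)
  have "(\<lambda>f. none a f \<and> none b f) = (\<lambda>f. \<forall>i\<in>M. f i \<in> - {a,b})"
    by (auto simp: none_def)
  then show ?thesis
    using prob_rectangle[OF M_subset, of "\<lambda>_. - {a,b}"] c by simp
qed

lemma prob_not_few:
  assumes "j \<in> {1,2,3}"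
  shows "prob (ev (\<lambda>f. \<not> few j f)) \<le> ((1331/1000 + 200/121) / 3) ^ card M"
proof -
  have "determined_on M (\<lambda>f. \<not> few j f)"
    by (intro determined_on_not determined_on_few)
  then have "prob (ev (\<lambda>f. \<not> few j f)) = card {f \<in> M \<rightarrow>\<^sub>E {1,2,3}. \<not> few j f} / 3 ^ card M"
    by (rule prob_determined_on[OF M_subset])
  also have "\<dots> \<le> (1331/1000 + 200/121) ^ card M / 3 ^ card M"
    using card_colourings_upper_tail[OF finite_M assms]
    by (intro divide_right_mono) (simp_all add: few_def not_less)
  finally show ?thesis by (simp only: power_divide)
qed

text \<open>Once \<open>a\<close> is absent from \<open>M\<close>, colour \<open>b\<close> takes
  about half of \<open>M\<close>, so a share below 2/5 is exponentially rare even among those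
  colourings.\<close>

lemma prob_none_few:
  assumes "a \<in> {1,2,3}" "b \<in> {1,2,3}" "a \<noteq> b"
  shows "prob (ev (\<lambda>f. none a f \<and> few b f)) \<le> ((729/1000 + 100/81) / 3) ^ card M"
proof -
  have "determined_on M (\<lambda>f. none a f \<and> few b f)"
    by (intro determined_on_conj[of M _ M]) auto
  then have "prob (ev (\<lambda>f. none a f \<and> few b f)) =
      card {f \<in> M \<rightarrow>\<^sub>E {1,2,3}. none a f \<and> few b f} / 3 ^ card M"
    by (rule prob_determined_on[OF M_subset])
  also have "{f \<in> M \<rightarrow>\<^sub>E {1,2,3}. none a f \<and> few b f} = {f \<in> M \<rightarrow>\<^sub>E {1,2,3} - {a}. few b f}"
    by (auto simp: none_def PiE_iff)
  also have "real (card \<dots>) / 3 ^ card M \<le> (729/1000 + 100/81) ^ card M / 3 ^ card M"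
    using card_colourings_lower_tail[OF finite_M, of "{1,2,3} - {a}" b] assms
    by (intro divide_right_mono) (simp_all add: few_def card_Diff_subset)
  finally show ?thesis by (simp only: power_divide)
qed

section \<open>Probability bounds for one, three and two good colours\<close>

text \<open>Missing \<open>M\<close> gives the first summand. The other one comes from colourings
  that miss a block, with Bonferroni over three blocks and six ordered pairs of blocks.\<close>

lemma prob_good_single_ge:
  assumes j: "j \<in> {1,2,3}" and t: "t \<ge> 2"
  defines "q \<equiv> (2/3 :: real) ^ t"
  shows "prob (ev (good j)) \<ge> (2/3) ^ card M +
    (1 - (2/3) ^ card M - ((1331/1000 + 200/121) / 3) ^ card M) * (3 * q - 6 * q\<^sup>2)"
proof -
  \<comment> \<open>The conjunct \<open>\<not> none j f\<close> makes the two ways of being good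
    disjoint, so their probabilities add up.\<close>
  define Q where "Q f \<longleftrightarrow> \<not> none j f \<and> few j f" for f
  have Q: "determined_on M Q"
    unfolding Q_def by (intro determined_on_conj[of M _ M] determined_on_not) auto
  define X where "X Z Y = (if Y = Z then {j} else {})" for Z Y :: "'v set"
  have X: "X Z Y \<subseteq> {1,2,3}" "X Z Y \<union> X Z' Y \<subseteq> {1,2,3}" for Z Z' Y
    using j by (auto simp: X_def)
  have Int: "avoiding Q (X Z) \<inter> avoiding Q (X Z') = avoiding Q (\<lambda>Y. X Z Y \<union> X Z' Y)" for Z Z'
    by (auto simp: avoiding_def ev_def)
  \<comment> \<open>Nonnegativity allows multiplying by the lower bound for
    \<open>prob (ev Q)\<close>; it needs \<open>q \<le> 1/2\<close>, hence
    \<open>t \<ge> 2\<close>.\<close>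
  have q: "0 \<le> 3 * q - 6 * q\<^sup>2"
  proof -
    have "q \<le> (2/3) ^ 2"
      unfolding q_def using t by (intro power_decreasing) auto
    then have "q * q \<le> (1/2) * q"
      by (intro mult_right_mono) (auto simp: q_def power2_eq_square)
    then show ?thesis by (simp add: power2_eq_square)
  qed
  obtain A B C where ABC: "Bs = {A, B, C}" "A \<noteq> B" "A \<noteq> C" "B \<noteq> C"
    by (rule blocks_obtain)
  have single: "prob (avoiding Q (X Z)) = prob (ev Q) * q" if "Z \<in> Bs" for Z
  proof -
    have "(\<Prod>Y\<in>Bs. (real (3 - card (X Z Y)) / 3) ^ t) = q"
      using that ABC by (auto simp: q_def X_def)
    then show ?thesis
      using prob_avoiding[OF Q, of "X Z"] X(1) by simp
  qed
  have double: "prob (avoiding Q (X Z) \<inter> avoiding Q (X Z')) = prob (ev Q) * q\<^sup>2"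
    if "Z \<in> Bs" "Z' \<in> Bs - {Z}" for Z Z'
  proof -
    have "(\<Prod>Y\<in>Bs. (real (3 - card (X Z Y \<union> X Z' Y)) / 3) ^ t) = q\<^sup>2"
      using that ABC by (auto simp: q_def X_def power2_eq_square)
    then show ?thesis
      using prob_avoiding[OF Q, of "\<lambda>Y. X Z Y \<union> X Z' Y"] X(2) Int by simp
  qed
  have union: "prob (\<Union>Z\<in>Bs. avoiding Q (X Z)) \<ge> prob (ev Q) * (3 * q - 6 * q\<^sup>2)"
  proof -
    have "(\<Sum>Z\<in>Bs. prob (avoiding Q (X Z))) = 3 * (prob (ev Q) * q)"
      using card_Bs by (simp add: single)
    moreover have "(\<Sum>Z\<in>Bs. \<Sum>Z'\<in>Bs - {Z}. prob (avoiding Q (X Z) \<inter> avoiding Q (X Z'))) =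
        6 * (prob (ev Q) * q\<^sup>2)"
      using card_Bs by (simp add: double)
    ultimately show ?thesis
      using measure_UN_ge_Bonferroni[of Bs "\<lambda>Z. avoiding Q (X Z)"] Q
      by (simp add: algebra_simps)
  qed
  have "1 = prob (ev (\<lambda>_. True))"
    by (simp add: ev_def prob_space)
  also have "ev (\<lambda>_. True) = ev Q \<union> (ev (none j) \<union> ev (\<lambda>f. \<not> few j f))"
    by (auto simp: ev_def Q_def)
  also have "prob \<dots> \<le> prob (ev Q) + (prob (ev (none j)) + prob (ev (\<lambda>f. \<not> few j f)))"
  proof -
    have "determined_on M (\<lambda>f. \<not> few j f)"
      by (intro determined_on_not determined_on_few)
    then have "ev (none j) \<in> events" "ev (\<lambda>f. \<not> few j f) \<in> events" "ev Q \<in> events"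
      using Q by (auto intro!: events_determined_on[OF M_subset])
    then show ?thesis
      by (intro order_trans[OF measure_Un_le] add_left_mono) auto
  qed
  finally have PQ: "prob (ev Q) \<ge> 1 - (2/3) ^ card M - ((1331/1000 + 200/121) / 3) ^ card M"
    using prob_none[OF j] prob_not_few[OF j] by linarith
  have "prob (ev (none j)) + prob (\<Union>Z\<in>Bs. avoiding Q (X Z)) = prob (ev (none j) \<union> (\<Union>Z\<in>Bs. avoiding Q (X Z)))"
  proof (rule finite_measure_Union[symmetric])
    show "ev (none j) \<inter> (\<Union>Z\<in>Bs. avoiding Q (X Z)) = {}"
      by (auto simp: ev_def avoiding_def Q_def)
  qed (use Q in \<open>auto intro!: events_determined_on[OF M_subset]\<close>)
  also have "\<dots> \<le> prob (ev (good j))"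
  proof (rule finite_measure_mono)
    show "ev (none j) \<union> (\<Union>Z\<in>Bs. avoiding Q (X Z)) \<subseteq> ev (good j)"
      by (auto simp: ev_def avoiding_def Q_def good_def misses_def X_def split: if_splits)
  qed (rule events_determined_on[OF subset_refl determined_on_good])
  finally show ?thesis
    using union mult_right_mono[OF PQ q] prob_none[OF j] by linarith
qed

text \<open>Each of the six bijections between blocks and colours forbids one colour on every block,
  with probability \<open>q ^ 3\<close> given \<open>Q\<close>. Two different bijections forbid two
  colours on some block, which costs a further factor \<open>2 ^ t\<close>; there are 30 ordered
  pairs.\<close>

lemma prob_good_all_ge:
  assumes t: "t \<ge> 3"
  defines "q \<equiv> (2/3 :: real) ^ t"
  shows "prob (ev (\<lambda>f. \<forall>j\<in>{1,2,3}. good j f)) \<ge>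
    (1 - 3 * ((1331/1000 + 200/121) / 3) ^ card M) * (q ^ 3 * (6 - 30 / 2 ^ t))"
proof -
  define Q where "Q f \<longleftrightarrow> (\<forall>j\<in>{1,2,3}. few j f)" for f
  have Q: "determined_on M Q"
    unfolding Q_def
    by (rule determined_onI, rule ball_cong[OF refl], rule determined_onD[OF determined_on_few])
  let ?Perm = "{\<pi>. \<pi> permutes {1,2,3::nat}}"
  have fin: "finite ?Perm" by (rule finite_permutations) simp
  have card_Perm: "card ?Perm = 6"
    using card_permutations[of "{1,2,3::nat}" 3] by (simp add: fact_numeral)
  \<comment> \<open>A fixed numbering of the blocks represents the bijections as permutations of
    \<open>{1,2,3}\<close>, whose number is known.\<close>
  obtain \<beta> where \<beta>: "bij_betw \<beta> Bs {1,2,3::nat}"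
    using finite_same_card_bij[of Bs "{1,2,3::nat}"] card_Bs by auto
  define X where "X \<pi> Z = {\<pi> (\<beta> Z)}" for \<pi> :: "nat \<Rightarrow> nat" and Z
  have in123: "\<pi> (\<beta> Z) \<in> {1,2,3}" if "\<pi> \<in> ?Perm" "Z \<in> Bs" for \<pi> Z
    using that \<beta> by (metis bij_betwE mem_Collect_eq permutes_in_image)
  have single: "prob (avoiding Q (X \<pi>)) = prob (ev Q) * q ^ 3" if "\<pi> \<in> ?Perm" for \<pi>
  proof -
    have "(\<Prod>Z\<in>Bs. (real (3 - card (X \<pi> Z)) / 3) ^ t) = q ^ 3"
      by (simp add: X_def q_def card_Bs)
    moreover have "X \<pi> Z \<subseteq> {1,2,3}" if "Z \<in> Bs" for Z
      using in123[OF \<open>\<pi> \<in> ?Perm\<close> that] unfolding X_def by blast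
    ultimately show ?thesis
      using prob_avoiding[OF Q, of "X \<pi>"] by simp
  qed
  have double: "prob (avoiding Q (X \<pi>) \<inter> avoiding Q (X \<rho>)) \<le> prob (ev Q) * (q ^ 3 / 2 ^ t)"
    if \<pi>: "\<pi> \<in> ?Perm" and \<rho>: "\<rho> \<in> ?Perm - {\<pi>}" for \<pi> \<rho>
  proof -
    obtain k where k: "\<pi> k \<noteq> \<rho> k"
    proof -
      have "\<pi> \<noteq> \<rho>" using \<rho> by blast
      then show thesis using that by blast
    qed
    have "k \<in> {1,2,3}"
    proof (rule ccontr)
      assume "k \<notin> {1,2,3}"
      then have "\<pi> k = k" "\<rho> k = k"
        using \<pi> \<rho> by (auto intro: permutes_not_in)
      with k show False by simp
    qed
    then have "k \<in> \<beta> ` Bs"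
      using \<beta> by (simp add: bij_betw_def)
    then obtain Z where Z: "Z \<in> Bs" "\<pi> (\<beta> Z) \<noteq> \<rho> (\<beta> Z)"
      using k by blast
    have "avoiding Q (X \<pi>) \<inter> avoiding Q (X \<rho>) = avoiding Q (\<lambda>Y. X \<pi> Y \<union> X \<rho> Y)"
      by (auto simp: avoiding_def ev_def)
    also have "prob \<dots> = prob (ev Q) * (\<Prod>Y\<in>Bs. (real (3 - card (X \<pi> Y \<union> X \<rho> Y)) / 3) ^ t)"
    proof (rule prob_avoiding[OF Q])
      show "X \<pi> Y \<union> X \<rho> Y \<subseteq> {1,2,3}" if "Y \<in> Bs" for Y
        using in123[OF \<pi> that] in123[OF _ that, of \<rho>] \<rho> unfolding X_def by blast
    qed
    \<comment> \<open>On \<open>Z\<close> only one colour remains; on every other block at least one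
      colour is forbidden.\<close>
    also have "\<dots> \<le> prob (ev Q) * (\<Prod>Y\<in>Bs. if Y = Z then (1/3) ^ t else q)"
    proof (intro mult_left_mono prod_mono conjI measure_nonneg)
      fix Y assume "Y \<in> Bs"
      show "(real (3 - card (X \<pi> Y \<union> X \<rho> Y)) / 3) ^ t \<le> (if Y = Z then (1/3) ^ t else q)"
      proof (cases "Y = Z")
        case True
        then show ?thesis using Z by (simp add: X_def)
      next
        case False
        have "card (X \<pi> Y \<union> X \<rho> Y) \<ge> 1"
          by (simp add: X_def card_insert_if)
        then show ?thesis
          using False unfolding q_def by (auto intro!: power_mono)
      qed
    qed simp
    also have "(\<Prod>Y\<in>Bs. if Y = Z then (1/3) ^ t else q) = (1/3) ^ t * q ^ 2"
    proof -
      have "(\<Prod>Y\<in>Bs. if Y = Z then (1/3) ^ t else q) = (1/3) ^ t * (\<Prod>Y\<in>Bs - {Z}. if Y = Z then (1/3) ^ t else q)"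
        using Z by (subst prod.remove[of _ Z]) auto
      also have "(\<Prod>Y\<in>Bs - {Z}. if Y = Z then (1/3) ^ t else q) = (\<Prod>Y\<in>Bs - {Z}. q)"
        by (intro prod.cong) auto
      finally show ?thesis using card_Bs Z by simp
    qed
    also have "\<dots> = q ^ 3 / 2 ^ t"
      by (simp add: q_def power_divide power3_eq_cube power2_eq_square)
    finally show ?thesis .
  qed
  have union: "prob (\<Union>\<pi>\<in>?Perm. avoiding Q (X \<pi>)) \<ge> prob (ev Q) * (q ^ 3 * (6 - 30 / 2 ^ t))"
  proof -
    have "(\<Sum>\<pi>\<in>?Perm. prob (avoiding Q (X \<pi>))) = 6 * (prob (ev Q) * q ^ 3)"
      using card_Perm by (simp add: single)
    moreover have "(\<Sum>\<pi>\<in>?Perm. \<Sum>\<rho>\<in>?Perm - {\<pi>}. prob (avoiding Q (X \<pi>) \<inter> avoiding Q (X \<rho>))) \<le>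
        30 * (prob (ev Q) * (q ^ 3 / 2 ^ t))"
    proof -
      have "(\<Sum>\<pi>\<in>?Perm. \<Sum>\<rho>\<in>?Perm - {\<pi>}. prob (avoiding Q (X \<pi>) \<inter> avoiding Q (X \<rho>))) \<le>
          (\<Sum>\<pi>\<in>?Perm. \<Sum>\<rho>\<in>?Perm - {\<pi>}. prob (ev Q) * (q ^ 3 / 2 ^ t))"
        using double by (intro sum_mono) auto
      also have "\<dots> = 30 * (prob (ev Q) * (q ^ 3 / 2 ^ t))"
        using card_Perm fin by simp
      finally show ?thesis .
    qed
    ultimately show ?thesis
      using measure_UN_ge_Bonferroni[OF fin, of "\<lambda>\<pi>. avoiding Q (X \<pi>)"] Q
      by (simp add: algebra_simps)
  qed
  have nonneg: "0 \<le> q ^ 3 * (6 - 30 / 2 ^ t)"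
  proof -
    \<comment> \<open>This is where \<open>t \<ge> 3\<close> enters: 30/8 is below 6.\<close>
    have "(2::real) ^ 3 \<le> 2 ^ t" using t by (intro power_increasing) auto
    then show ?thesis by (simp add: q_def field_simps)
  qed
  have "1 = prob (ev (\<lambda>_. True))"
    by (simp add: ev_def prob_space)
  also have "ev (\<lambda>_. True) = ev Q \<union> (\<Union>j\<in>{1,2,3}. ev (\<lambda>f. \<not> few j f))"
    by (auto simp: ev_def Q_def)
  also have "prob \<dots> \<le> prob (ev Q) + (\<Sum>j\<in>{1,2,3}. prob (ev (\<lambda>f. \<not> few j f)))"
  proof -
    have "determined_on M (\<lambda>f. \<not> few j f)" for j
      by (intro determined_on_not determined_on_few)
    then have "ev (\<lambda>f. \<not> few j f) \<in> events" "ev Q \<in> events" for j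
      using Q by (auto intro!: events_determined_on[OF M_subset])
    then show ?thesis
      by (intro order_trans[OF measure_Un_le] add_left_mono finite_measure_subadditive_finite) auto
  qed
  also have "(\<Sum>j\<in>{1,2,3}. prob (ev (\<lambda>f. \<not> few j f))) \<le>
      (\<Sum>j\<in>{1,2,3::nat}. ((1331/1000 + 200/121) / 3) ^ card M)"
    by (intro sum_mono prob_not_few)
  finally have PQ: "prob (ev Q) \<ge> 1 - 3 * ((1331/1000 + 200/121) / 3) ^ card M"
    by simp
  have "prob (\<Union>\<pi>\<in>?Perm. avoiding Q (X \<pi>)) \<le> prob (ev (\<lambda>f. \<forall>j\<in>{1,2,3}. good j f))"
  proof (rule finite_measure_mono)
    show "(\<Union>\<pi>\<in>?Perm. avoiding Q (X \<pi>)) \<subseteq> ev (\<lambda>f. \<forall>j\<in>{1,2,3}. good j f)"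
    proof
      fix \<omega> assume "\<omega> \<in> (\<Union>\<pi>\<in>?Perm. avoiding Q (X \<pi>))"
      then obtain \<pi> where \<pi>: "\<pi> permutes {1,2,3}" "\<omega> \<in> avoiding Q (X \<pi>)" by auto
      have "good j (\<lambda>i. \<sigma> i \<omega>)" if j: "j \<in> {1,2,3}" for j
      proof -
        have "bij_betw (\<pi> \<circ> \<beta>) Bs {1,2,3}"
          using \<beta> permutes_imp_bij[OF \<pi>(1)] by (rule bij_betw_trans)
        then obtain Z where "Z \<in> Bs" "\<pi> (\<beta> Z) = j"
          using j unfolding bij_betw_def by (metis comp_apply imageE)
        then have "misses Z j (\<lambda>i. \<sigma> i \<omega>)"
          using \<pi>(2) by (auto simp: avoiding_def ev_def misses_def X_def)
        moreover have "few j (\<lambda>i. \<sigma> i \<omega>)"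
          using \<pi>(2) j by (auto simp: avoiding_def ev_def Q_def)
        ultimately show ?thesis
          using \<open>Z \<in> Bs\<close> by (auto simp: good_def)
      qed
      moreover have "\<omega> \<in> space P"
        using \<pi>(2) by (simp add: avoiding_def ev_def)
      ultimately show "\<omega> \<in> ev (\<lambda>f. \<forall>j\<in>{1,2,3}. good j f)"
        unfolding ev_def by blast
    qed
  qed (rule events_good)
  then show ?thesis
    using union mult_right_mono[OF PQ nonneg] by linarith
qed

text \<open>Each colour is good through \<open>M\<close> or through a block, which gives four cases:
  both miss \<open>M\<close>; one misses \<open>M\<close> while the other has few points there and
  misses a block (two cases, three blocks each); both miss blocks.\<close>

lemma prob_good_pair_le:
  assumes ab: "a \<in> {1,2,3}" "b \<in> {1,2,3}" "a \<noteq> b"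
  defines "q \<equiv> (2/3 :: real) ^ t"
  shows "prob (ev (\<lambda>f. \<forall>j\<in>{a,b}. good j f)) \<le>
    (1/3) ^ card M + 6 * ((729/1000 + 100/81) / 3) ^ card M * q + 6 * q\<^sup>2 + 3 * (1/3) ^ t"
proof -
  define X where "X c Z Y = (if Y = Z then {c} else {})" for c :: nat and Z Y :: "'v set"
  have X: "X c Z Y \<subseteq> {1,2,3}" if "c \<in> {1,2,3}" for c Z Y
    using that by (auto simp: X_def)
  define NF where "NF c d f \<longleftrightarrow> none c f \<and> few d f" for c d f
  have NF: "determined_on M (NF c d)" for c d
    unfolding NF_def by (intro determined_on_conj[of M _ M]) auto
  have True: "determined_on M (\<lambda>_. True)" by (simp add: determined_on_def)
  have T_events: "avoiding (\<lambda>_. True) Y \<in> events" for Y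
    by (rule events_avoiding[OF True])
  have UN_events: "(\<Union>Y\<in>Bs. avoiding (\<lambda>_. True) (\<lambda>T. X a Z T \<union> X b Y T)) \<in> events" for Z
    by (intro sets.finite_UN finite_Bs T_events)
  obtain A B C where ABC: "Bs = {A, B, C}" "A \<noteq> B" "A \<noteq> C" "B \<noteq> C"
    by (rule blocks_obtain)
  let ?N = "ev (\<lambda>f. none a f \<and> none b f)"
  let ?U = "\<lambda>c d. \<Union>Z\<in>Bs. avoiding (NF c d) (X d Z)"
  \<comment> \<open>The condition on \<open>M\<close> is dropped here, which can only enlarge the
    event.\<close>
  let ?W = "\<Union>Z\<in>Bs. \<Union>Y\<in>Bs. avoiding (\<lambda>_. True) (\<lambda>T. X a Z T \<union> X b Y T)"
  have U_le: "prob (?U c d) \<le> 3 * ((729/1000 + 100/81) / 3) ^ card M * q"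
    if "c \<in> {1,2,3}" "d \<in> {1,2,3}" "c \<noteq> d" for c d
  proof -
    have "prob (avoiding (NF c d) (X d Z)) \<le> ((729/1000 + 100/81) / 3) ^ card M * q" if "Z \<in> Bs" for Z
    proof -
      have "(\<Prod>Y\<in>Bs. (real (3 - card (X d Z Y)) / 3) ^ t) = q"
        using that ABC by (auto simp: q_def X_def)
      then have "prob (avoiding (NF c d) (X d Z)) = prob (ev (NF c d)) * q"
        using prob_avoiding[OF NF[of c d] X[OF \<open>d \<in> {1,2,3}\<close>, of Z]] by simp
      also have "\<dots> \<le> ((729/1000 + 100/81) / 3) ^ card M * q"
        using prob_none_few[OF \<open>c \<in> {1,2,3}\<close> \<open>d \<in> {1,2,3}\<close> \<open>c \<noteq> d\<close>]
        by (intro mult_right_mono) (simp_all add: NF_def[abs_def] q_def)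
      finally show ?thesis .
    qed
    then have "(\<Sum>Z\<in>Bs. prob (avoiding (NF c d) (X d Z))) \<le> (\<Sum>Z\<in>Bs. ((729/1000 + 100/81) / 3) ^ card M * q)"
      by (intro sum_mono) auto
    moreover have "prob (?U c d) \<le> (\<Sum>Z\<in>Bs. prob (avoiding (NF c d) (X d Z)))"
      using NF by (intro finite_measure_subadditive_finite) auto
    ultimately show ?thesis
      using card_Bs by (simp only: sum_constant)
  qed
  have W_le: "prob ?W \<le> 6 * q\<^sup>2 + 3 * (1/3) ^ t"
  proof -
    have "prob ?W \<le> (\<Sum>Z\<in>Bs. prob (\<Union>Y\<in>Bs. avoiding (\<lambda>_. True) (\<lambda>T. X a Z T \<union> X b Y T)))"
      using UN_events by (intro finite_measure_subadditive_finite) auto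
    also have "\<dots> \<le> (\<Sum>Z\<in>Bs. \<Sum>Y\<in>Bs. prob (avoiding (\<lambda>_. True) (\<lambda>T. X a Z T \<union> X b Y T)))"
      using T_events by (intro sum_mono finite_measure_subadditive_finite) auto
    \<comment> \<open>If both colours miss the same block, one colour remains on it; otherwise two
      blocks lose one colour each.\<close>
    also have "\<dots> = (\<Sum>Z\<in>Bs. \<Sum>Y\<in>Bs. if Y = Z then (1/3) ^ t else q\<^sup>2)"
    proof (intro sum.cong refl)
      fix Z Y assume ZY: "Z \<in> Bs" "Y \<in> Bs"
      have "prob (ev (\<lambda>_. True)) = 1"
        by (simp add: ev_def prob_space)
      then have "prob (avoiding (\<lambda>_. True) (\<lambda>T. X a Z T \<union> X b Y T)) =
          (\<Prod>T\<in>Bs. (real (3 - card (X a Z T \<union> X b Y T)) / 3) ^ t)"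
        using prob_avoiding[OF True, of "\<lambda>T. X a Z T \<union> X b Y T"] X[OF ab(1)] X[OF ab(2)]
        by simp
      also have "\<dots> = (if Y = Z then (1/3) ^ t else q\<^sup>2)"
        using ZY ABC ab(3) by (auto simp: X_def q_def power2_eq_square card_insert_if)
      finally show "prob (avoiding (\<lambda>_. True) (\<lambda>T. X a Z T \<union> X b Y T)) = (if Y = Z then (1/3) ^ t else q\<^sup>2)" .
    qed
    also have "\<dots> = 6 * q\<^sup>2 + 3 * (1/3) ^ t"
      using ABC by simp
    finally show ?thesis .
  qed
  have "determined_on M (\<lambda>f. none a f \<and> none b f)"
    by (intro determined_on_conj[of M _ M]) auto
  then have events: "?N \<in> events" "?U c d \<in> events" "?W \<in> events" for c d
    using NF UN_events by (simp_all add: events_determined_on[OF M_subset] sets.finite_UN)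
  have "ev (\<lambda>f. \<forall>j\<in>{a,b}. good j f) \<subseteq> ?N \<union> (?U a b \<union> (?U b a \<union> ?W))"
  proof
    fix \<omega> assume \<omega>: "\<omega> \<in> ev (\<lambda>f. \<forall>j\<in>{a,b}. good j f)"
    let ?f = "\<lambda>i. \<sigma> i \<omega>"
    have sp: "\<omega> \<in> space P" and g: "good a ?f" "good b ?f"
      using \<omega> by (auto simp: ev_def)
    have U: "\<omega> \<in> ?U c d" if "none c ?f" "few d ?f" "Z \<in> Bs" "misses Z d ?f" for c d Z
      using that sp by (auto simp: avoiding_def ev_def NF_def X_def misses_def)
    have W: "\<omega> \<in> ?W" if "Z \<in> Bs" "misses Z a ?f" "Y \<in> Bs" "misses Y b ?f" for Z Y
      using that sp by (intro UN_I[of Z] UN_I[of Y]) (auto simp: avoiding_def ev_def X_def misses_def)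
    show "\<omega> \<in> ?N \<union> (?U a b \<union> (?U b a \<union> ?W))"
    proof (cases "none a ?f")
      case True
      show ?thesis
      proof (cases "none b ?f")
        case True
        with \<open>none a ?f\<close> sp have "\<omega> \<in> ?N" by (simp add: ev_def)
        then show ?thesis by blast
      next
        case False
        with g(2) obtain Z where "few b ?f" "Z \<in> Bs" "misses Z b ?f" by (auto simp: good_def)
        with \<open>none a ?f\<close> have "\<omega> \<in> ?U a b" by (intro U)
        then show ?thesis by blast
      qed
    next
      case False
      with g(1) obtain Z where Z: "few a ?f" "Z \<in> Bs" "misses Z a ?f" by (auto simp: good_def)
      show ?thesis
      proof (cases "none b ?f")
        case True
        with Z have "\<omega> \<in> ?U b a" by (intro U)
        then show ?thesis by blast
      next
        case False
        with g(2) obtain Y where "Y \<in> Bs" "misses Y b ?f" by (auto simp: good_def)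
        with Z have "\<omega> \<in> ?W" by (intro W)
        then show ?thesis by blast
      qed
    qed
  qed
  then have "prob (ev (\<lambda>f. \<forall>j\<in>{a,b}. good j f)) \<le> prob (?N \<union> (?U a b \<union> (?U b a \<union> ?W)))"
    using events by (intro finite_measure_mono sets.Un) auto
  also have "\<dots> \<le> prob ?N + (prob (?U a b) + (prob (?U b a) + prob ?W))"
    using events
    by (intro order_trans[OF measure_Un_le] add_left_mono sets.Un order_refl)
  finally show ?thesis
    using prob_none_none[OF ab] U_le[OF ab] U_le[OF ab(2,1) not_sym[OF ab(3)]] W_le by linarith
qed

end

section \<open>The block family is decreasing\<close>

text \<open>Both cardinalities that \<open>family2\<close> restricts are monotone in
  \<open>X\<close>.\<close>

lemma decreasing_block_family:
  assumes "finite V"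
  shows "decreasing_family V (block_family V M A B C)"
  unfolding decreasing_family_def
proof (intro conjI ballI allI impI)
  show "block_family V M A B C \<subseteq> Pow V"
    by (auto simp: block_family_def family1_def family2_def)
next
  fix X Y assume X: "X \<in> block_family V M A B C" and Y: "Y \<subseteq> X"
  show "Y \<in> block_family V M A B C"
  proof (cases "X \<in> family1 V M")
    case True
    then have "Y \<in> family1 V M" using Y by (auto simp: family1_def)
    then show ?thesis by (simp add: block_family_def)
  next
    case False
    with X have X2: "X \<subseteq> V" "real (card (X \<inter> M)) < 0.4 * real (card M)"
      "card {Z \<in> {A, B, C}. X \<inter> Z \<noteq> {}} \<le> 2"
      by (auto simp: block_family_def family2_def)
    have "finite X" using X2(1) assms by (rule finite_subset)
    then have "card (Y \<inter> M) \<le> card (X \<inter> M)"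
      using Y by (intro card_mono) auto
    moreover have "card {Z \<in> {A, B, C}. Y \<inter> Z \<noteq> {}} \<le> card {Z \<in> {A, B, C}. X \<inter> Z \<noteq> {}}"
      using Y by (intro card_mono) auto
    ultimately have "Y \<in> family2 V M A B C"
      using X2 Y unfolding family2_def by auto
    then show ?thesis by (simp add: block_family_def)
  qed
qed

section \<open>Asymptotic comparison of the bounds\<close>

text \<open>Dividing by powers of \<open>u = (2/3) ^ s\<close> leaves convergent factors, and both
  sides scale like \<open>u ^ 4\<close>. With \<open>x = (2/3) ^ 3 = 8/27\<close> the limits are
  \<open>1 + 3 * x\<close>, \<open>6 * x ^ 3\<close> and \<open>6 * x ^ 2\<close>, so the claim
  becomes \<open>x < 1/3\<close>. The shift 3 in \<open>t = s + 3\<close> achieves this; the shift 2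
  would not.\<close>

lemma eventually_bounds_compare:
  defines "\<rho> \<equiv> (1331/1000 + 200/121) / (3::real)" and "\<delta> \<equiv> (729/1000 + 100/81) / (3::real)"
  defines "q \<equiv> \<lambda>s::nat. (2/3::real) ^ (s + 3)"
  defines "lower1 \<equiv> \<lambda>s. (2/3) ^ s + (1 - (2/3) ^ s - \<rho> ^ s) * (3 * q s - 6 * (q s)\<^sup>2)"
    and "lower3 \<equiv> \<lambda>s. (1 - 3 * \<rho> ^ s) * (q s ^ 3 * (6 - 30 / 2 ^ (s + 3)))"
    and "upper2 \<equiv> \<lambda>s. (1/3) ^ s + 6 * \<delta> ^ s * q s + 6 * (q s)\<^sup>2 + 3 * (1/3) ^ (s + 3)"
  shows "\<forall>\<^sub>F s in sequentially. 0 < lower1 s \<and> 0 < lower3 s \<and> upper2 s * upper2 s < lower1 s * lower3 s"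
proof -
  define u where "u s = (2/3::real) ^ s" for s :: nat
  \<comment> \<open>The constants come from \<open>q = 8/27 * u\<close>: 8/9 is
    \<open>3 * (8/27)\<close>, 128/243 is \<open>6 * (8/27) ^ 2\<close>, 512/19683 is
    \<open>(8/27) ^ 3\<close>, 16/9 is \<open>6 * (8/27)\<close>, and 10/9 is
    \<open>1 + 3/27\<close>. The bases 3/4 and \<open>3/2 * \<delta>\<close> result from division by
    4/9.\<close>
  define l1 where "l1 s = 1 + (1 - u s - \<rho> ^ s) * (8/9 - 128/243 * u s)" for s :: nat
  define l3 where "l3 s = (1 - 3 * \<rho> ^ s) * (512/19683 * (6 - 30/8 * (1/2) ^ s))" for s :: nat
  define u2 where "u2 s = 10/9 * (3/4) ^ s + 16/9 * (3/2 * \<delta>) ^ s + 128/243" for s :: nat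
  have q: "q s = 8/27 * u s" for s
    by (simp add: q_def u_def power_add power3_eq_cube)
  have lower1: "lower1 s = u s * l1 s" for s
    unfolding lower1_def l1_def q u_def[symmetric] by (simp add: field_simps power2_eq_square)
  have lower3: "lower3 s = u s ^ 3 * l3 s" for s
  proof -
    have "30 / 2 ^ (s + 3) = 30/8 * (1/2::real) ^ s"
      by (simp add: power_add power_one_over)
    then show ?thesis
      unfolding lower3_def l3_def q by (simp add: power_mult_distrib power_divide)
  qed
  have upper2: "upper2 s = u s ^ 2 * u2 s" for s
  proof -
    have sq: "u s ^ 2 = (4/9) ^ s"
      by (simp add: u_def power2_eq_square flip: power_mult_distrib)
    have e1: "(1/3) ^ s = u s ^ 2 * (3/4) ^ s"
      unfolding sq by (simp flip: power_mult_distrib)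
    have "u s ^ 2 * (3/2 * \<delta>) ^ s = (4/9 * (3/2 * \<delta>)) ^ s"
      by (simp only: sq power_mult_distrib)
    also have "\<dots> = (\<delta> * (2/3)) ^ s" by (simp add: mult.commute)
    also have "\<dots> = \<delta> ^ s * u s" by (simp only: u_def power_mult_distrib)
    finally have e2: "\<delta> ^ s * u s = u s ^ 2 * (3/2 * \<delta>) ^ s" ..
    have "upper2 s = 10/9 * (1/3) ^ s + 16/9 * (\<delta> ^ s * u s) + 128/243 * u s ^ 2"
      unfolding upper2_def q by (simp add: power_mult_distrib power_add power_divide)
    also have "\<dots> = u s ^ 2 * u2 s"
      unfolding e1 e2 u2_def by (simp only: distrib_left mult.left_commute mult.commute)
    finally show ?thesis .
  qed
  \<comment> \<open>The tail bases must lie below 3 and 2 respectively to give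
    \<open>\<rho> < 1\<close> and \<open>3/2 * \<delta> < 1\<close>.\<close>
  have pow: "u \<longlonglongrightarrow> 0" "(\<lambda>s. \<rho> ^ s) \<longlonglongrightarrow> 0" "(\<lambda>s. (1/2::real) ^ s) \<longlonglongrightarrow> 0"
    "(\<lambda>s. (3/4::real) ^ s) \<longlonglongrightarrow> 0" "(\<lambda>s. (3/2 * \<delta>) ^ s) \<longlonglongrightarrow> 0"
    unfolding u_def[abs_def] by (rule LIMSEQ_realpow_zero; simp add: \<rho>_def \<delta>_def)+
  have "l1 \<longlonglongrightarrow> 1 + (1 - 0 - 0) * (8/9 - 128/243 * 0)"
    unfolding l1_def[abs_def] by (intro tendsto_intros pow)
  then have l1: "l1 \<longlonglongrightarrow> 17/9" by simp
  have "l3 \<longlonglongrightarrow> (1 - 3 * 0) * (512/19683 * (6 - 30/8 * 0))"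
    unfolding l3_def[abs_def] by (intro tendsto_intros pow)
  then have l3: "l3 \<longlonglongrightarrow> 1024/6561" by simp
  have "u2 \<longlonglongrightarrow> 10/9 * 0 + 16/9 * 0 + 128/243"
    unfolding u2_def[abs_def] by (intro tendsto_intros pow)
  then have u2: "u2 \<longlonglongrightarrow> 128/243" by simp
  \<comment> \<open>Over the common denominator \<open>3 ^ 10\<close> the products are
    \<open>17 * 1024\<close> and \<open>16 * 1024\<close>.\<close>
  have "(\<lambda>s. l1 s * l3 s - u2 s * u2 s) \<longlonglongrightarrow> 17/9 * (1024/6561) - 128/243 * (128/243)"
    by (intro tendsto_intros l1 l3 u2)
  then have "\<forall>\<^sub>F s in sequentially. 0 < l1 s * l3 s - u2 s * u2 s"
    by (rule order_tendstoD) simp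
  moreover have "\<forall>\<^sub>F s in sequentially. 0 < l1 s" "\<forall>\<^sub>F s in sequentially. 0 < l3 s"
    using order_tendstoD(1)[OF l1, of 0] order_tendstoD(1)[OF l3, of 0] by simp_all
  ultimately show ?thesis
  proof eventually_elim
    case (elim s)
    have u: "u s > 0" by (simp add: u_def)
    have "upper2 s * upper2 s = u s ^ 4 * (u2 s * u2 s)"
      by (simp add: upper2 power2_eq_square power4_eq_xxxx)
    also have "\<dots> < u s ^ 4 * (l1 s * l3 s)"
      using elim u by (intro mult_strict_left_mono) auto
    also have "\<dots> = lower1 s * lower3 s"
      by (simp add: lower1 lower3 power3_eq_cube power4_eq_xxxx)
    finally show ?case
      using elim u by (simp add: lower1 lower3)
  qed
qed

section \<open>Transfer to the concrete family and the strict inequality\<close>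

lemma block_colouring_of_partition:
  assumes "is_block_partition s M A B C" "iid_uniform_colouring P {1..ground_size s} \<sigma>"
  shows "block_colouring P {1..ground_size s} \<sigma> M {A, B, C} (s + 3)"
proof -
  interpret prob_space P
    using assms(2) by (simp add: iid_uniform_colouring_def)
  have part: "M \<union> A \<union> B \<union> C = {1..ground_size s}" "card A = s + 3" "card B = s + 3" "card C = s + 3"
    "M \<inter> A = {}" "M \<inter> B = {}" "M \<inter> C = {}" "A \<inter> B = {}" "A \<inter> C = {}" "B \<inter> C = {}"
    using assms(1) by (auto simp: is_block_partition_def part_size_def)
  \<comment> \<open>Disjoint sets of positive size \<open>s + 3\<close> are distinct, so
    \<open>{A, B, C}\<close> has three elements.\<close>
  then have "A \<noteq> B" "A \<noteq> C" "B \<noteq> C" by auto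
  show ?thesis
  proof unfold_locales
    show "indep_vars (\<lambda>_. count_space UNIV) \<sigma> {1..ground_size s}"
      using assms(2) by (simp add: iid_uniform_colouring_def)
    show "disjoint {A, B, C}"
      using part by (auto simp: disjoint_def)
    show "card {A, B, C} = 3"
      using \<open>A \<noteq> B\<close> \<open>A \<noteq> C\<close> \<open>B \<noteq> C\<close> by simp
  qed (use assms(2) part in \<open>auto simp: iid_uniform_colouring_def\<close>)
qed

text \<open>For three blocks this turns meeting at most two into missing at least one.\<close>

lemma card_Collect_le_iff_ex_not:
  assumes "finite S" "card S = Suc n"
  shows "card {x \<in> S. R x} \<le> n \<longleftrightarrow> (\<exists>x\<in>S. \<not> R x)"
proof
  assume "card {x \<in> S. R x} \<le> n"
  then have "{x \<in> S. R x} \<noteq> S" using assms by auto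
  then show "\<exists>x\<in>S. \<not> R x" by auto
next
  assume "\<exists>x\<in>S. \<not> R x"
  then have "{x \<in> S. R x} \<subset> S" by auto
  then have "card {x \<in> S. R x} < card S" by (rule psubset_card_mono[OF assms(1)])
  then show "card {x \<in> S. R x} \<le> n" using assms by simp
qed

lemma (in block_colouring) colour_class_in_block_family_iff:
  assumes "Bs = {A, B, C}"
  shows "{i\<in>V. f i = j} \<in> block_family V M A B C \<longleftrightarrow> good j f"
proof -
  define X where "X = {i\<in>V. f i = j}"
  have X_subset: "X \<subseteq> V" by (auto simp: X_def)
  have "X \<in> family1 V M \<longleftrightarrow> none j f"
    using M_subset by (auto simp: X_def family1_def none_def)
  moreover have "real (card (X \<inter> M)) < 0.4 * real (card M) \<longleftrightarrow> few j f"
  proof -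
    have "X \<inter> M = {i\<in>M. f i = j}"
      using M_subset by (auto simp: X_def)
    then have "few j f \<longleftrightarrow> 5 * card (X \<inter> M) < 2 * card M"
      by (simp add: few_def)
    then show ?thesis by linarith
  qed
  moreover have "card {Z \<in> Bs. X \<inter> Z \<noteq> {}} \<le> 2 \<longleftrightarrow> (\<exists>Z\<in>Bs. misses Z j f)"
  proof -
    have "X \<inter> Z = {} \<longleftrightarrow> misses Z j f" if "Z \<in> Bs" for Z
      using that V_eq by (auto simp: X_def misses_def)
    then show ?thesis
      using card_Collect_le_iff_ex_not[OF finite_Bs, of 2 "\<lambda>Z. X \<inter> Z \<noteq> {}"] card_Bs by simp
  qed
  ultimately have "X \<in> block_family V M A B C \<longleftrightarrow> good j f"
    using X_subset unfolding block_family_def family2_def good_def unfolding assms by blast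
  then show ?thesis by (simp add: X_def)
qed

lemma (in block_colouring) colour_event_block_family:
  assumes "Bs = {A, B, C}"
  shows "colour_event P V \<sigma> (block_family V M A B C) L = ev (\<lambda>f. \<forall>j\<in>L. good j f)"
  unfolding colour_event_def ev_def colour_class_in_block_family_iff[OF assms] ..

text \<open>The bounds depend only on \<open>s\<close>, so one threshold serves all partitions,
  probability spaces and colourings.\<close>

lemma eventually_block_family_correlation:
  "\<forall>\<^sub>F s in sequentially. \<forall>M A B C (P :: 'w measure) (\<sigma> :: nat \<Rightarrow> 'w \<Rightarrow> nat).
     is_block_partition s M A B C \<longrightarrow>
     iid_uniform_colouring P {1..ground_size s} \<sigma> \<longrightarrow>
     (let V = {1..ground_size s};
          Pr = (\<lambda>L. measure P (colour_event P V \<sigma> (block_family V M A B C) L))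
      in Pr {3} * Pr {1, 2, 3} > Pr {1, 3} * Pr {2, 3})"
  using eventually_bounds_compare
proof eventually_elim
  case (elim s)
  show ?case
  proof (intro allI impI)
    fix M A B C and P :: "'w measure" and \<sigma> :: "nat \<Rightarrow> 'w \<Rightarrow> nat"
    assume part: "is_block_partition s M A B C" and iid: "iid_uniform_colouring P {1..ground_size s} \<sigma>"
    interpret block_colouring P "{1..ground_size s}" \<sigma> M "{A, B, C}" "s + 3"
      using part iid by (rule block_colouring_of_partition)
    have card_M: "card M = s" using part by (simp add: is_block_partition_def)
    define Pr where "Pr L = prob (ev (\<lambda>f. \<forall>j\<in>L. good j f))" for L
    let ?r = "(1331/1000 + 200/121) / (3::real)" and ?d = "(729/1000 + 100/81) / (3::real)"
    let ?q = "(2/3::real) ^ (s + 3)"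
    let ?l1 = "(2/3) ^ s + (1 - (2/3) ^ s - ?r ^ s) * (3 * ?q - 6 * ?q\<^sup>2)"
    let ?l3 = "(1 - 3 * ?r ^ s) * (?q ^ 3 * (6 - 30 / 2 ^ (s + 3)))"
    let ?u2 = "(1/3) ^ s + 6 * ?d ^ s * ?q + 6 * ?q\<^sup>2 + 3 * (1/3) ^ (s + 3)"
    have l1: "?l1 \<le> Pr {3}"
      using prob_good_single_ge[of 3] unfolding Pr_def card_M by simp
    have l3: "?l3 \<le> Pr {1, 2, 3}"
      using prob_good_all_ge unfolding Pr_def card_M by simp
    have u2: "Pr {1, 3} \<le> ?u2" "Pr {2, 3} \<le> ?u2"
      using prob_good_pair_le[of 1 3] prob_good_pair_le[of 2 3] unfolding Pr_def card_M by simp_all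
    \<comment> \<open>The pair bound is squared, and the positive lower bounds are multiplied
      below.\<close>
    have "Pr {1, 3} * Pr {2, 3} \<le> ?u2 * ?u2"
      using u2 by (intro mult_mono) (auto simp: Pr_def)
    also have "\<dots> < ?l1 * ?l3"
      using elim by blast
    also have "\<dots> \<le> Pr {3} * Pr {1, 2, 3}"
      using elim by (intro mult_mono l1 l3) (auto simp: Pr_def)
    finally show "(let V = {1..ground_size s};
          Pr = (\<lambda>L. measure P (colour_event P V \<sigma> (block_family V M A B C) L))
      in Pr {3} * Pr {1, 2, 3} > Pr {1, 3} * Pr {2, 3})"
      unfolding Let_def colour_event_block_family[OF refl] Pr_def .
  qed
qed

section \<open>Refutation of the conjecture of Welsh\<close>

lemma block_partition_exists: "\<exists>M A B C. is_block_partition s M A B C"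
proof (intro exI)
  show "is_block_partition s {1..s} {s + 1..2 * s + 3} {2 * s + 4..3 * s + 6} {3 * s + 7..4 * s + 9}"
    by (auto simp: is_block_partition_def ground_size_def part_size_def)
qed

text \<open>The case split only acts on a null set; the conjecture bounds the values at every sample
  point, not just almost surely.\<close>

definition coordinate_colour :: "nat \<Rightarrow> (nat \<Rightarrow> nat) \<Rightarrow> nat" where
  "coordinate_colour i \<omega> = (if \<omega> i \<le> 3 then \<omega> i else 0)"

text \<open>The product distribution realises the colouring on the sample type fixed in
  \<open>welsh_conjecture\<close>; coordinates outside \<open>V\<close> have the default value
  0.\<close>

lemma iid_uniform_coordinate_colour:
  assumes "finite V"
  shows "iid_uniform_colouring (measure_pmf (Pi_pmf V 0 (\<lambda>_. pmf_of_set {1,2,3}))) V coordinate_colour"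
    (is "iid_uniform_colouring (measure_pmf ?p) _ _")
  unfolding iid_uniform_colouring_def
proof (intro conjI ballI)
  show "prob_space (measure_pmf ?p)"
    by (rule measure_pmf.prob_space_axioms)
  show "prob_space.indep_vars (measure_pmf ?p) (\<lambda>_. count_space UNIV) coordinate_colour V"
  proof -
    have eq: "coordinate_colour = (\<lambda>i \<omega>. (\<lambda>k. if k \<le> 3 then k else 0) (\<omega> i))"
      by (simp add: fun_eq_iff coordinate_colour_def)
    show ?thesis
      unfolding eq using indep_vars_Pi_pmf[OF assms]
      by (rule prob_space.indep_vars_compose2[OF measure_pmf.prob_space_axioms]) simp
  qed
  fix i assume i: "i \<in> V"
  have "map_pmf (coordinate_colour i) ?p = map_pmf (\<lambda>k. if k \<le> 3 then k else 0) (map_pmf (\<lambda>\<omega>. \<omega> i) ?p)"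
    by (simp add: pmf.map_comp comp_def coordinate_colour_def[abs_def])
  also have "\<dots> = map_pmf (\<lambda>k. if k \<le> 3 then k else 0) (pmf_of_set {1,2,3})"
    using i by (subst Pi_pmf_component[OF assms]) simp
  \<comment> \<open>The truncation is the identity on the support.\<close>
  also have "\<dots> = map_pmf (\<lambda>k. k) (pmf_of_set {1,2,3})"
    by (intro map_pmf_cong refl) auto
  finally have "map_pmf (coordinate_colour i) ?p = pmf_of_set {1,2,3}"
    by simp
  then show "distr (measure_pmf ?p) (count_space UNIV) (coordinate_colour i) = measure_pmf (pmf_of_set {1,2,3})"
    by (metis map_pmf_rep_eq)
qed

text \<open>The counterexample has \<open>n = 3\<close>, \<open>p = 1/3\<close>, so that
  \<open>\<Lambda>\<close> has probability 0, and the singletons of 1, 2 and 3 as \<open>I\<close>,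
  \<open>J\<close> and \<open>K\<close>. Clearing denominators in the conditional inequality
  contradicts the strict one.\<close>

lemma not_welsh_conjecture: "\<not> welsh_conjecture"
proof
  assume welsh: welsh_conjecture
  obtain s where s: "\<forall>M A B C (P :: (nat \<Rightarrow> nat) measure) (\<sigma> :: nat \<Rightarrow> (nat \<Rightarrow> nat) \<Rightarrow> nat).
     is_block_partition s M A B C \<longrightarrow>
     iid_uniform_colouring P {1..ground_size s} \<sigma> \<longrightarrow>
     (let V = {1..ground_size s};
          Pr = (\<lambda>L. measure P (colour_event P V \<sigma> (block_family V M A B C) L))
      in Pr {3} * Pr {1, 2, 3} > Pr {1, 3} * Pr {2, 3})"
    using eventually_happens'[OF sequentially_bot eventually_block_family_correlation] by blast
  obtain M A B C where part: "is_block_partition s M A B C"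
    using block_partition_exists by blast
  define m where "m = ground_size s"
  define P where "P = measure_pmf (Pi_pmf {1..m} 0 (\<lambda>_. pmf_of_set {1,2,3::nat}))"
  define F where "F = block_family {1..m} M A B C"
  let ?E = "colour_event P {1..m} coordinate_colour F"
  have iid: "iid_uniform_colouring P {1..m} coordinate_colour"
    unfolding P_def by (rule iid_uniform_coordinate_colour) simp
  have corr: "measure P (?E {1,3}) * measure P (?E {2,3}) < measure P (?E {3}) * measure P (?E {1,2,3})"
    using s[rule_format, OF part iid[unfolded m_def]] by (simp add: Let_def F_def m_def)
  interpret block_colouring P "{1..m}" coordinate_colour M "{A, B, C}" "s + 3"
    using block_colouring_of_partition[OF part] iid by (simp add: m_def)
  \<comment> \<open>The strict inequality itself excludes a null conditioning event, as its right
    side exceeds a nonnegative number.\<close>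
  have pos: "0 < prob (?E {3})"
  proof -
    have "0 \<le> prob (?E {1,3}) * prob (?E {2,3})" by simp
    also note corr
    finally have "prob (?E {3}) \<noteq> 0" by auto
    then show ?thesis by (simp add: zero_less_measure_iff)
  qed
  have "neg_correlated_given P (?E {1}) (?E {2}) (?E {3})"
  proof (rule welsh[unfolded welsh_conjecture_def, rule_format, where n = 3 and p = "1/3"])
    show "prob_space P" by (rule prob_space_axioms)
    show "indep_vars (\<lambda>_. count_space UNIV) coordinate_colour {1..m}" by (rule indep)
    show "coordinate_colour i \<omega> \<in> insert 0 {1..3}" for i \<omega>
      by (auto simp: coordinate_colour_def)
    show "\<P>(\<omega> in P. coordinate_colour i \<omega> = j) = 1/3" if "i \<in> {1..m}" "j \<in> {1..3}" for i j
    proof -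
      have "j \<in> {1,2,3}" using that(2) by auto
      then have "{j} \<inter> {1,2,3} = {j}" by auto
      moreover have "coordinate_colour i -` {j} \<inter> space P = {\<omega> \<in> space P. coordinate_colour i \<omega> = j}"
        by auto
      ultimately show ?thesis
        using prob_colour_in[OF that(1), of "{j}"] by simp
    qed
    show "decreasing_family {1..m} F"
      unfolding F_def by (rule decreasing_block_family) simp
    show "{1::nat} \<subseteq> {1..3} \<and> {2::nat} \<subseteq> {1..3} \<and> {3::nat} \<subseteq> {1..3} \<and>
        {1::nat} \<inter> {2} = {} \<and> {1::nat} \<inter> {3} = {} \<and> {2::nat} \<inter> {3} = {} \<and> 0 < prob (?E {3})"
      using pos by auto
  qed
  then have neg: "prob {\<omega> \<in> space P. \<omega> \<in> ?E {1} \<inter> ?E {2} \<and> \<omega> \<in> ?E {3}} / prob {\<omega> \<in> space P. \<omega> \<in> ?E {3}} \<le>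
      prob {\<omega> \<in> space P. \<omega> \<in> ?E {1} \<and> \<omega> \<in> ?E {3}} / prob {\<omega> \<in> space P. \<omega> \<in> ?E {3}} *
      (prob {\<omega> \<in> space P. \<omega> \<in> ?E {2} \<and> \<omega> \<in> ?E {3}} / prob {\<omega> \<in> space P. \<omega> \<in> ?E {3}})"
    unfolding neg_correlated_given_def cond_prob_def .
  have "{\<omega> \<in> space P. \<omega> \<in> ?E {1} \<inter> ?E {2} \<and> \<omega> \<in> ?E {3}} = ?E {1,2,3}"
    "{\<omega> \<in> space P. \<omega> \<in> ?E {1} \<and> \<omega> \<in> ?E {3}} = ?E {1,3}"
    "{\<omega> \<in> space P. \<omega> \<in> ?E {2} \<and> \<omega> \<in> ?E {3}} = ?E {2,3}"
    "{\<omega> \<in> space P. \<omega> \<in> ?E {3}} = ?E {3}"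
    by (auto simp: colour_event_def)
  with neg have "prob (?E {1,2,3}) / prob (?E {3}) \<le>
      prob (?E {1,3}) / prob (?E {3}) * (prob (?E {2,3}) / prob (?E {3}))"
    by simp
  with pos have "prob (?E {3}) * prob (?E {1,2,3}) \<le> prob (?E {1,3}) * prob (?E {2,3})"
    by (simp add: field_simps)
  with corr show False by simp
qed

theorem mainTheorem7:
  shows "(\<forall>s\<ge>1. \<forall>M A B C. is_block_partition s M A B C \<longrightarrow>
            decreasing_family {1..ground_size s} (block_family {1..ground_size s} M A B C)) \<and>
         (\<forall>\<^sub>F s in sequentially. \<forall>M A B C (P :: 'w measure) (\<sigma> :: nat \<Rightarrow> 'w \<Rightarrow> nat).
            is_block_partition s M A B C \<longrightarrow>
            iid_uniform_colouring P {1..ground_size s} \<sigma> \<longrightarrow>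
            (let V = {1..ground_size s};
                 Pr = (\<lambda>L. measure P (colour_event P V \<sigma> (block_family V M A B C) L))
             in Pr {3} * Pr {1, 2, 3} > Pr {1, 3} * Pr {2, 3})) \<and>
         \<not> welsh_conjecture"
  using decreasing_block_family eventually_block_family_correlation not_welsh_conjecture by blast

end
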